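(* Let $d\ge 1$ be an integer, let $p\in[0,1]$, and let $\mathcal{E}(\sigma)=(1-p)\,\sigma+\frac{p}{d}I_d$ be the depolarizing channel with depolarizing factor $p$ on a $d$-dimensional quantum system. For every pure quantum state $\rho$ (a $d\times d$ density matrix) and every positive integer $n$, the state $\mathcal{E}^n(\rho)$ obtained by applying $n$ consecutive depolarizing channels with factor $p$ to $\rho$ is $$\mathcal{E}^n(\rho)=(1-p)^n\rho+\frac{1-(1-p)^n}{d}\,I_d .$$
   Context: States are described by density matrices (positive semidefinite matrices of trace $1$) on $\mathbb{C}^d$, where $d$ is the dimension of the system ($d=2^m$ for $m$ qubits). A state $\rho$ is pure if it is a rank-one projector. $I_d$ is the $d\times d$ identity matrix. The depolarizing channel with depolarizing factor (probability) $p$ maps a density matrix $\sigma$ to $\mathcal{E}(\sigma)=(1-p)\sigma+\frac{p}{d}I_d$. $\mathcal{E}^n$ denotes the $n$-fold composition of $\mathcal{E}$ with itself. *)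

theory Defs
  imports
    "Jordan_Normal_Form.Matrix"
    "Jordan_Normal_Form.Schur_Decomposition"
    "Jordan_Normal_Form.DL_Rank"
begin

definition mat_trace :: "'a :: comm_monoid_add mat \<Rightarrow> 'a" where
  "mat_trace A = (\<Sum>i<dim_row A. A $$ (i, i))"

definition hermitian_mat :: "complex mat \<Rightarrow> bool" where
  "hermitian_mat A \<longleftrightarrow> mat_adjoint A = A"

(* In the order of HOL-Library.Complex_Order, 0 \<le> z says that z is real and nonnegative. *)
definition positive_semidefinite :: "nat \<Rightarrow> complex mat \<Rightarrow> bool" where
  "positive_semidefinite d A \<longleftrightarrow>
     A \<in> carrier_mat d d \<and> hermitian_mat A \<and>
     (\<forall>v \<in> carrier_vec d. 0 \<le> (A *\<^sub>v v) \<bullet>c v)"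

definition density_matrix :: "nat \<Rightarrow> complex mat \<Rightarrow> bool" where
  "density_matrix d A \<longleftrightarrow> positive_semidefinite d A \<and> mat_trace A = 1"

definition projector :: "nat \<Rightarrow> complex mat \<Rightarrow> bool" where
  "projector d A \<longleftrightarrow> A \<in> carrier_mat d d \<and> hermitian_mat A \<and> A * A = A"

definition pure_state :: "nat \<Rightarrow> complex mat \<Rightarrow> bool" where
  "pure_state d A \<longleftrightarrow> density_matrix d A \<and> projector d A \<and> vec_space.rank d A = 1"

(* Intended for d-by-d arguments; matrix addition takes its dimensions from the
   right-hand summand, here the identity. *)
definition depolarizing_channel :: "nat \<Rightarrow> real \<Rightarrow> complex mat \<Rightarrow> complex mat" where
  "depolarizing_channel d p \<sigma> =
     complex_of_real (1 - p) \<cdot>\<^sub>m \<sigma> + complex_of_real (p / real d) \<cdot>\<^sub>m 1\<^sub>m d"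

end

theory Submission
  imports Defs
begin

text \<open>The channel sends a combination of \<open>\<sigma>\<close> and the identity to another:
  it scales both weights by 1 - p and adds p/d to the identity's. So the weight of
  \<open>\<sigma>\<close> is geometric, and that of the identity solves c_(n+1) = (1-p) c_n + p/d
  with c_0 = 0. \<open>depolarizing_channel_funpow\<close> solves this by induction on n.\<close>

lemma depolarizing_channel_funpow:
  assumes "\<sigma> \<in> carrier_mat d d"
  shows "(depolarizing_channel d p ^^ n) \<sigma> =
    complex_of_real ((1 - p) ^ n) \<cdot>\<^sub>m \<sigma> +
    complex_of_real ((1 - (1 - p) ^ n) / real d) \<cdot>\<^sub>m 1\<^sub>m d"
proof (induction n)
  case 0
  show ?case using assms by (intro eq_matI) auto
next
  case (Suc n)
  \<comment> \<open>The recurrence for the identity's weight: with q = (1-p)^n, (1-p)(1-q) + p = 1 -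
    (1-p)q.\<close>
  have coeff: "(1 - p) * ((1 - (1 - p) ^ n) / real d) + p / real d = (1 - (1 - p) ^ Suc n) / real d"
    by (simp add: add_divide_distrib[symmetric] algebra_simps)
  have "(depolarizing_channel d p ^^ Suc n) \<sigma> =
    complex_of_real ((1 - p) * (1 - p) ^ n) \<cdot>\<^sub>m \<sigma> +
    complex_of_real ((1 - p) * ((1 - (1 - p) ^ n) / real d) + p / real d) \<cdot>\<^sub>m 1\<^sub>m d"
    unfolding funpow.simps comp_def Suc.IH depolarizing_channel_def
    \<comment> \<open>Compared entrywise; \<open>assms\<close> makes the dimensions of
      \<open>\<sigma>\<close> agree with those of the identity.\<close>
    using assms by (intro eq_matI) (auto simp: algebra_simps)
  then show ?case unfolding coeff by simp
qed

theorem theorem1: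
  fixes d n :: nat and p :: real and \<rho> :: "complex mat"
  assumes "d \<ge> 1"
    and "0 \<le> p" and "p \<le> 1"
    and "pure_state d \<rho>"
    and "n \<ge> 1"
  shows "(depolarizing_channel d p ^^ n) \<rho> =
    complex_of_real ((1 - p) ^ n) \<cdot>\<^sub>m \<rho> +
    complex_of_real ((1 - (1 - p) ^ n) / real d) \<cdot>\<^sub>m 1\<^sub>m d"
proof (rule depolarizing_channel_funpow)
  show "\<rho> \<in> carrier_mat d d"
    using assms(4) by (simp add: pure_state_def projector_def)
qed

end
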